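(* Let $n$ be an odd prime. Then the inequality $$T_n(\kappa)\ge 4\frac{\log n}{\sqrt{n}}$$ holds for at most $4\sqrt{n}\log n$ values of $\kappa\in\{1,\ldots,n-1\}$.
   Context: Here $\log$ is the natural logarithm. For an odd prime $n$ and an integer $j$, let $r(j,n)$ denote the unique integer congruent to $j$ modulo $n$ in the set $\{-(n-1)/2,\ldots,(n-1)/2\}$. For $\kappa\in\{1,\ldots,n-1\}$, define $$T_n(\kappa):=\sum_{q=1}^{(n-1)/2}\frac{1}{q\,|r(q\kappa,n)|}.$$ *)

theory Defs
  imports Complex_Main "HOL-Number_Theory.Cong"
begin

(* Intended for odd n: then the interval consists of n consecutive integers,
   one in each residue class (centred_residue_ex1). *)
definition centred_residue :: "int \<Rightarrow> nat \<Rightarrow> int" where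
  "centred_residue j n =
     (THE k. k \<in> {- ((int n - 1) div 2)..(int n - 1) div 2} \<and> [k = j] (mod int n))"

lemma centred_residue_ex1:
  assumes "odd n"
  shows "\<exists>!k. k \<in> {- ((int n - 1) div 2)..(int n - 1) div 2} \<and> [k = j] (mod int n)"
proof -
  obtain m where n: "int n = 2 * int m + 1"
    using assms by (auto elim!: oddE)
  have half: "(int n - 1) div 2 = int m"
    using n by simp
  define k where "k = (j + int m) mod int n - int m"
  have bounds: "0 \<le> (j + int m) mod int n" "(j + int m) mod int n < int n"
    using n pos_mod_sign[of "int n"] pos_mod_bound[of "int n"] by force+
  have cong: "[k = j] (mod int n)"
    unfolding k_def cong_def by (simp add: mod_diff_left_eq)
  show ?thesis
  proof (rule ex1I[of _ k])
    show "k \<in> {- ((int n - 1) div 2)..(int n - 1) div 2} \<and> [k = j] (mod int n)"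
      using bounds cong n unfolding half k_def by auto
  next
    fix l
    assume l: "l \<in> {- ((int n - 1) div 2)..(int n - 1) div 2} \<and> [l = j] (mod int n)"
    then have "[l + int m = j + int m] (mod int n)"
      by (simp add: cong_add_rcancel)
    moreover have "(l + int m) mod int n = l + int m"
      using l n unfolding half by (intro mod_pos_pos_trivial) auto
    ultimately show "l = k"
      unfolding k_def cong_def by simp
  qed
qed

definition T :: "nat \<Rightarrow> nat \<Rightarrow> real" where
  "T n \<kappa> = (\<Sum>q = 1..(n - 1) div 2.
     1 / (real q * \<bar>real_of_int (centred_residue (int q * int \<kappa>) n)\<bar>))"

end

theory Submission
  imports Defs
begin

text \<open>
  The bound is Markov's inequality for the first moment of \<^term>\<open>T n\<close>. Put
  \<open>m = (n - 1) / 2\<close> and let \<open>H\<close> be the harmonic sum \<open>1 + 1/2 + \<dots> + 1/m\<close>. For a fixed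
  \<open>q \<le> m\<close>, multiplication by \<open>q\<close> is invertible modulo the prime \<open>n\<close>, so as \<open>\<kappa>\<close> runs over
  \<open>1, \<dots>, n - 1\<close> the centred residues of \<open>q \<kappa>\<close> are distinct nonzero integers in \<open>[-m, m]\<close>
  (\<open>centred_residue_mult_inj_on\<close>, \<open>centred_residue_mult_mem\<close>), and the sum of the reciprocals of
  their absolute values is at most \<open>2 H\<close> (\<open>sum_inverse_centred_residue_le\<close>). Weighting by \<open>1/q\<close>
  and summing over \<open>q\<close> shows that the values of \<^term>\<open>T n\<close> add up to at most \<open>2 H\<^sup>2\<close>
  (\<open>sum_T_le\<close>).

  Since \<open>H \<le> 1 + ln n \<le> 2 ln n\<close> for \<open>n \<ge> 3\<close>, the total is at most \<open>8 (ln n)\<^sup>2\<close>. Hence at most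
  \<open>8 (ln n)\<^sup>2 / (4 ln n / \<surd>n) = 2 \<surd>n ln n\<close> values of \<open>\<kappa>\<close> reach the threshold, half of the
  number that is claimed.
\<close>

text \<open>Each new term \<open>1 / (k + 1)\<close> is at most \<open>ln (k + 1) - ln k\<close>, by \<open>ln x \<le> x - 1\<close> at
  \<open>x = k / (k + 1)\<close>.\<close>

lemma harmonic_sum_le:
  assumes "m \<ge> 1"
  shows "(\<Sum>k = 1..m. 1 / real k) \<le> 1 + ln (real m)"
  using assms
proof (induction m rule: dec_induct)
  case base
  then show ?case by simp
next
  case (step k)
  have "ln (real k / real (Suc k)) \<le> real k / real (Suc k) - 1"
    using step by (intro ln_le_minus_one) simp
  moreover have "ln (real k / real (Suc k)) = ln (real k) - ln (real (Suc k))"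
    using step by (simp add: ln_div)
  moreover have "real k / real (Suc k) - 1 = - (1 / real (Suc k))"
    by (simp add: field_simps)
  ultimately show ?case using step by simp
qed

lemma centred_residue:
  assumes "odd n"
  shows "centred_residue j n \<in> {- ((int n - 1) div 2)..(int n - 1) div 2}"
    and "[centred_residue j n = j] (mod int n)"
  using theI'[OF centred_residue_ex1[OF assms, of j]] unfolding centred_residue_def by auto

lemma centred_residue_mult_inj_on:
  assumes "odd n" and "coprime q n"
  shows "inj_on (\<lambda>\<kappa>. centred_residue (int q * int \<kappa>) n) {1..n - 1}"
proof (rule inj_onI)
  fix a b
  assume ab: "a \<in> {1..n - 1}" "b \<in> {1..n - 1}"
    and eq: "centred_residue (int q * int a) n = centred_residue (int q * int b) n"
  have "[int q * int a = int q * int b] (mod int n)"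
    using centred_residue(2)[OF assms(1)] eq by (metis cong_sym cong_trans)
  then have "[int a = int b] (mod int n)"
    using assms(2) by (simp add: cong_mult_lcancel)
  then have "[a = b] (mod n)"
    by (simp add: cong_int_iff)
  then show "a = b"
    using ab by (intro cong_less_modulus_unique_nat[of a b n]) auto
qed

lemma centred_residue_mult_mem:
  assumes "odd n" and "coprime q n" and "\<kappa> \<in> {1..n - 1}"
  shows "centred_residue (int q * int \<kappa>) n
    \<in> {- ((int n - 1) div 2)..(int n - 1) div 2} - {0}"
proof -
  have "centred_residue (int q * int \<kappa>) n \<noteq> 0"
  proof
    assume "centred_residue (int q * int \<kappa>) n = 0"
    then have "int n dvd int q * int \<kappa>"
      using centred_residue(2)[OF assms(1), of "int q * int \<kappa>"]
      by (simp add: cong_0_iff cong_sym_eq[of 0])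
    then have "n dvd q * \<kappa>"
      by (simp flip: of_nat_mult)
    then have "n dvd \<kappa>"
      using assms(2) by (simp add: coprime_commute coprime_dvd_mult_right_iff)
    then show False
      using assms(3) by (auto dest: dvd_imp_le)
  qed
  then show ?thesis
    using centred_residue(1)[OF assms(1)] by blast
qed

lemma sum_inverse_abs_symmetric_interval:
  "(\<Sum>k \<in> {- int m..int m} - {0}. 1 / \<bar>real_of_int k\<bar>) = 2 * (\<Sum>k = 1..m. 1 / real k)"
proof -
  have split: "{- int m..int m} - {0} = int ` {1..m} \<union> (\<lambda>k. - int k) ` {1..m}" (is "?L = ?R")
  proof
    show "?L \<subseteq> ?R"
    proof
      fix x
      assume x: "x \<in> ?L"
      then have "nat \<bar>x\<bar> \<in> {1..m}" and "x = int (nat \<bar>x\<bar>) \<or> x = - int (nat \<bar>x\<bar>)"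
        by auto
      then show "x \<in> ?R"
        by blast
    qed
  qed auto
  have "(\<Sum>k \<in> ?L. 1 / \<bar>real_of_int k\<bar>)
      = (\<Sum>k \<in> int ` {1..m}. 1 / \<bar>real_of_int k\<bar>)
        + (\<Sum>k \<in> (\<lambda>k. - int k) ` {1..m}. 1 / \<bar>real_of_int k\<bar>)"
    unfolding split by (intro sum.union_disjoint) auto
  also have "\<dots> = 2 * (\<Sum>k = 1..m. 1 / real k)"
    by (subst (1 2) sum.reindex) (auto simp: inj_on_def)
  finally show ?thesis .
qed

lemma sum_inverse_centred_residue_le:
  assumes "odd n" and "coprime q n"
  shows "(\<Sum>\<kappa> = 1..n - 1. 1 / \<bar>real_of_int (centred_residue (int q * int \<kappa>) n)\<bar>)
    \<le> 2 * (\<Sum>k = 1..(n - 1) div 2. 1 / real k)"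
proof -
  let ?r = "\<lambda>\<kappa>. centred_residue (int q * int \<kappa>) n"
  have half: "(int n - 1) div 2 = int ((n - 1) div 2)"
    using assms(1) by (auto elim!: oddE)
  have "(\<Sum>\<kappa> = 1..n - 1. 1 / \<bar>real_of_int (?r \<kappa>)\<bar>)
      = (\<Sum>k \<in> ?r ` {1..n - 1}. 1 / \<bar>real_of_int k\<bar>)"
    by (subst sum.reindex[OF centred_residue_mult_inj_on[OF assms]]) simp
  also have "\<dots> \<le> (\<Sum>k \<in> {- int ((n - 1) div 2)..int ((n - 1) div 2)} - {0}.
      1 / \<bar>real_of_int k\<bar>)"
  proof (rule sum_mono2)
    show "?r ` {1..n - 1} \<subseteq> {- int ((n - 1) div 2)..int ((n - 1) div 2)} - {0}"
      unfolding half[symmetric] by (intro image_subsetI centred_residue_mult_mem[OF assms])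
  qed auto
  finally show ?thesis
    unfolding sum_inverse_abs_symmetric_interval .
qed

text \<open>Primality makes every \<open>q \<le> (n - 1) / 2\<close> coprime to \<open>n\<close>, so that the bound for a single \<open>q\<close>
  applies to each inner sum after the order of summation is exchanged.\<close>

lemma sum_T_le:
  assumes "prime n" and "odd n"
  shows "(\<Sum>\<kappa> = 1..n - 1. T n \<kappa>) \<le> 2 * (\<Sum>k = 1..(n - 1) div 2. 1 / real k)\<^sup>2"
proof -
  let ?H = "\<Sum>k = 1..(n - 1) div 2. 1 / real k"
  have "(\<Sum>\<kappa> = 1..n - 1. T n \<kappa>) = (\<Sum>q = 1..(n - 1) div 2. 1 / real q *
      (\<Sum>\<kappa> = 1..n - 1. 1 / \<bar>real_of_int (centred_residue (int q * int \<kappa>) n)\<bar>))"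
    unfolding T_def by (subst sum.swap) (simp add: sum_distrib_left)
  also have "\<dots> \<le> (\<Sum>q = 1..(n - 1) div 2. 1 / real q * (2 * ?H))"
  proof (intro sum_mono mult_left_mono)
    fix q
    assume q: "q \<in> {1..(n - 1) div 2}"
    then have "\<not> n dvd q"
      by (auto dest: dvd_imp_le)
    then have "coprime q n"
      using assms(1) by (simp add: coprime_commute prime_imp_coprime)
    then show "(\<Sum>\<kappa> = 1..n - 1. 1 / \<bar>real_of_int (centred_residue (int q * int \<kappa>) n)\<bar>)
        \<le> 2 * ?H"
      by (rule sum_inverse_centred_residue_le[OF assms(2)])
  qed simp
  also have "\<dots> = 2 * ?H\<^sup>2"
    unfolding sum_distrib_right[symmetric] by (simp add: power2_eq_square)
  finally show ?thesis .
qed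

theorem lemma1:
  fixes n :: nat
  assumes "prime n" and "odd n"
  shows "real (card {\<kappa> \<in> {1..n - 1}. T n \<kappa> \<ge> 4 * (ln (real n) / sqrt (real n))})
           \<le> 4 * sqrt (real n) * ln (real n)"
proof -
  let ?H = "\<Sum>k = 1..(n - 1) div 2. 1 / real k"
  define S where "S = {\<kappa> \<in> {1..n - 1}. T n \<kappa> \<ge> 4 * (ln (real n) / sqrt (real n))}"
  have n3: "n \<ge> 3"
    using assms prime_ge_2_nat[of n] by (cases "n = 2") auto
  have ln1: "ln (real n) \<ge> 1"
    using n3 exp_le by (subst ln_ge_iff) auto
  have "?H \<le> 1 + ln (real ((n - 1) div 2))"
    using n3 by (intro harmonic_sum_le) auto
  also have "\<dots> \<le> 1 + ln (real n)"
    using n3 by simp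
  also have "\<dots> \<le> 2 * ln (real n)"
    using ln1 by simp
  finally have H: "?H\<^sup>2 \<le> (2 * ln (real n))\<^sup>2"
    by (intro power_mono) (auto intro: sum_nonneg)
  have "real (card S) * (4 * (ln (real n) / sqrt (real n))) \<le> (\<Sum>\<kappa> \<in> S. T n \<kappa>)"
    by (rule sum_bounded_below) (simp add: S_def)
  also have "\<dots> \<le> (\<Sum>\<kappa> = 1..n - 1. T n \<kappa>)"
    by (rule sum_mono2) (auto simp: S_def T_def intro!: sum_nonneg)
  also have "\<dots> \<le> 2 * (2 * ln (real n))\<^sup>2"
    using sum_T_le[OF assms] H by linarith
  finally have "real (card S) * 4 * ln (real n) \<le> 8 * sqrt (real n) * ln (real n) * ln (real n)"
    using n3 by (simp add: field_simps power2_eq_square)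
  then have "real (card S) * 4 \<le> 8 * sqrt (real n) * ln (real n)"
    using ln1 by (subst (asm) mult_le_cancel_right) auto
  moreover have "0 \<le> sqrt (real n) * ln (real n)"
    using ln1 by simp
  ultimately show ?thesis
    unfolding S_def by linarith
qed

end
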